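(* Let $G$ be a simple, connected, finite and planar graph with $n\geq 4$ vertices and $r = \mathrm{girth}(G) = \mathrm{circum}(G)$. Then \[|E(G)| \leq 2n-4.\]
   Context: For a graph $G$ containing at least one cycle, $\mathrm{girth}(G)$ and $\mathrm{circum}(G)$ are the lengths of a shortest and of a longest cycle in $G$; they are defined only for graphs containing a cycle, so the hypothesis entails that $G$ contains a cycle. $E(G)$ is the edge set of $G$. *)

theory Defs
  imports "HOL-Analysis.Analysis" "Graph_Theory.Graph_Theory"
begin

text \<open>
  Finite simple graphs are the symmetric digraphs of locale \<open>graph\<close>, in which
  every undirected edge is present as two opposite arcs. Hence \<open>arcs G\<close> has twice as many
  elements as the edge set, and the edges are taken as unordered pairs of end vertices.
\<close>

definition edges :: "('a, 'b) pre_digraph \<Rightarrow> 'a set set" where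
  "edges G = (\<lambda>e. {tail G e, head G e}) ` arcs G"

text \<open>
  The closed walk \<open>u, v, u\<close> along an arc and its reverse is a directed cycle of length 2
  but not a cycle of the undirected graph. In a simple graph the bound \<open>3 \<le> length p\<close>
  excludes exactly these.
\<close>

definition graph_cycle :: "('a, 'b) pre_digraph \<Rightarrow> 'b list \<Rightarrow> bool" where
  "graph_cycle G p \<longleftrightarrow> pre_digraph.cycle G p \<and> 3 \<le> length p"

definition cycle_lengths :: "('a, 'b) pre_digraph \<Rightarrow> nat set" where
  "cycle_lengths G = {length p | p. graph_cycle G p}"

text \<open>
  Both are meaningful only if \<open>G\<close> contains a cycle; finiteness of the set of lengths is
  lemma \<open>finite_cycle_lengths\<close> below.
\<close>

definition girth :: "('a, 'b) pre_digraph \<Rightarrow> nat" where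
  "girth G = Min (cycle_lengths G)"

definition circum :: "('a, 'b) pre_digraph \<Rightarrow> nat" where
  "circum G = Max (cycle_lengths G)"

lemma finite_cycle_lengths:
  assumes "Digraph.graph G"
  shows "finite (cycle_lengths G)"
proof -
  interpret Digraph.graph G by fact
  have "length p \<le> card (verts G)" if "cycle p" for p
  proof -
    from that obtain u where u: "awalk u p u" "distinct (tl (awalk_verts u p))"
      by (auto simp: cycle_def)
    have "set (tl (awalk_verts u p)) \<subseteq> verts G"
      using u(1) by (metis awalkE' awalk_verts_in_verts awalk_verts_non_Nil list.set_sel(2)
        awalk_def subsetI)
    then have "length (tl (awalk_verts u p)) \<le> card (verts G)"
      using u(2) by (metis card_mono distinct_card finite_verts)
    then show ?thesis by (simp add: length_awalk_verts)
  qed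
  then have "cycle_lengths G \<subseteq> {..card (verts G)}"
    by (auto simp: cycle_lengths_def graph_cycle_def)
  then show ?thesis by (rule finite_subset) simp
qed

text \<open>
  A drawing in the plane: vertices are distinct points, every edge is an injective path
  joining its ends, no edge passes through a further vertex, and two edges meet at most in
  common ends.
\<close>

definition plane_drawing ::
  "('a, 'b) pre_digraph \<Rightarrow> ('a \<Rightarrow> real^2) \<Rightarrow> ('a set \<Rightarrow> real \<Rightarrow> real^2) \<Rightarrow> bool" where
  "plane_drawing G \<phi> \<gamma> \<longleftrightarrow>
     inj_on \<phi> (verts G) \<and>
     (\<forall>e \<in> edges G. Path_Connected.arc (\<gamma> e) \<and>
        {pathstart (\<gamma> e), pathfinish (\<gamma> e)} = \<phi> ` e \<and>
        path_image (\<gamma> e) \<inter> \<phi> ` verts G = \<phi> ` e) \<and>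
     (\<forall>e \<in> edges G. \<forall>e' \<in> edges G. e \<noteq> e' \<longrightarrow>
        path_image (\<gamma> e) \<inter> path_image (\<gamma> e') = \<phi> ` (e \<inter> e'))"

definition planar :: "('a, 'b) pre_digraph \<Rightarrow> bool" where
  "planar G \<longleftrightarrow> (\<exists>\<phi> \<gamma>. plane_drawing G \<phi> \<gamma>)"

end

theory Submission
  imports Defs
begin

text \<open>
  The hypothesis on \<open>r\<close> says that all cycles have the same length.
  All neighbours of the first vertex \<open>v\<close> of a longest path lie on this path. A neighbour that is not the
  second vertex closes a cycle with the initial segment of the path up to it, and different
  neighbours give cycles of different lengths, so \<open>v\<close> has degree at most 2. Deleting
  \<open>v\<close> reduces the bound to four vertices, where a fifth edge would create a triangle
  and a 4-cycle.
\<close>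

text \<open>Cycles are lists of vertices over a bare set of edges, so that deleting a vertex only
  filters \<open>E\<close> and no digraph has to be rebuilt.\<close>

definition vertex_cycle :: "'a set set \<Rightarrow> 'a list \<Rightarrow> bool" where
  "vertex_cycle E xs \<longleftrightarrow> distinct xs \<and> 3 \<le> length xs \<and>
     successively (\<lambda>x y. {x, y} \<in> E) xs \<and> {last xs, hd xs} \<in> E"

text \<open>A path of maximal length cannot be prolonged at its head.\<close>

lemma exists_longest_path:
  assumes "finite V" "v \<in> V"
  obtains xs where "xs \<noteq> []" "distinct xs" "set xs \<subseteq> V" "successively P xs"
    "\<And>w. w \<in> V - set xs \<Longrightarrow> \<not> P w (hd xs)"
proof -
  define Q where "Q = {xs. xs \<noteq> [] \<and> distinct xs \<and> set xs \<subseteq> V \<and> successively P xs}"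
  have "Q \<subseteq> {xs. set xs \<subseteq> V \<and> distinct xs}" by (auto simp: Q_def)
  then have "finite Q"
    using finite_subset_distinct[OF assms(1)] by (metis (lifting) finite_subset)
  moreover have "[v] \<in> Q" using assms(2) by (auto simp: Q_def)
  ultimately have "Max (length ` Q) \<in> length ` Q" by (intro Max_in) auto
  then obtain xs where xs: "xs \<in> Q" "length xs = Max (length ` Q)" by force
  have max: "length ys \<le> length xs" if "ys \<in> Q" for ys
    using that \<open>finite Q\<close> xs(2) by simp
  show thesis
  proof (rule that)
    fix w assume w: "w \<in> V - set xs"
    show "\<not> P w (hd xs)"
    proof
      assume "P w (hd xs)"
      then have "w # xs \<in> Q"
        using w xs by (auto simp: Q_def successively_Cons)
      then show False using max by fastforce
    qed
  qed (use xs in \<open>auto simp: Q_def\<close>)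
qed

lemma exists_degree_le_2:
  assumes "finite V" "V \<noteq> {}"
    and E: "\<And>e. e \<in> E \<Longrightarrow> e \<subseteq> V \<and> card e = 2"
    and len: "\<And>xs. vertex_cycle E xs \<Longrightarrow> length xs = r"
  shows "\<exists>v\<in>V. card {e \<in> E. v \<in> e} \<le> 2"
proof -
  obtain xs where xs: "xs \<noteq> []" "distinct xs" "set xs \<subseteq> V"
      "successively (\<lambda>x y. {x, y} \<in> E) xs"
    and max: "\<And>w. w \<in> V - set xs \<Longrightarrow> {w, hd xs} \<notin> E"
    using exists_longest_path[of V _ "\<lambda>x y. {x, y} \<in> E"] assms(1,2) by blast
  obtain v ys where vys: "xs = v # ys" using xs(1) by (cases xs) auto
  \<comment> \<open>The vertices \<open>v\<close>, \<open>ys ! 0\<close>, ..., \<open>ys ! i\<close>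
    number \<open>i + 2\<close>. If they form a cycle then \<open>i = r - 2\<close>. An index out of
    range does no harm, since the right-hand side serves only as a set of at most two
    elements.\<close>
  have "{e \<in> E. v \<in> e} \<subseteq> {{v, ys ! 0}, {v, ys ! (r - 2)}}"
  proof
    fix e assume "e \<in> {e \<in> E. v \<in> e}"
    then have e: "e \<in> E" "v \<in> e" by auto
    then obtain w where w: "e = {v, w}" "w \<noteq> v"
      using E[of e] by (auto simp: card_2_iff)
    have "w \<in> set xs" using max[of w] E[OF e(1)] e(1) w vys by (auto simp: insert_commute)
    then obtain i where i: "i < length ys" "w = ys ! i"
      using w(2) vys by (auto simp: in_set_conv_nth)
    have "i = r - 2" if "i \<noteq> 0"
    proof -
      let ?c = "v # take (Suc i) ys"
      have "xs = ?c @ drop (Suc i) ys" using vys by simp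
      then have "successively (\<lambda>x y. {x, y} \<in> E) ?c"
        using xs(4) by (metis successively_append_iff)
      moreover have "last ?c = w" using i by (simp add: take_Suc_conv_app_nth)
      ultimately have "vertex_cycle E ?c"
        using xs(2) vys i that e(1) w(1)
        by (auto simp: vertex_cycle_def insert_commute dest: in_set_takeD)
      then show ?thesis using len i by fastforce
    qed
    then show "e \<in> {{v, ys ! 0}, {v, ys ! (r - 2)}}" using w i by auto
  qed
  then have "card {e \<in> E. v \<in> e} \<le> card {{v, ys ! 0}, {v, ys ! (r - 2)}}"
    by (intro card_mono) auto
  also have "\<dots> \<le> 2" by (simp add: card_insert_if)
  finally show ?thesis using xs(3) vys by auto
qed

text \<open>A vertex \<open>v\<close> of degree at most 2 leaves at most three edges on the other
  three vertices. Five edges therefore force equality in both counts: \<open>v\<close> has two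
  neighbours and the other vertices form a triangle.\<close>

lemma card_edges_le_of_4_vertices:
  assumes V: "card V = 4"
    and E: "\<And>e. e \<in> E \<Longrightarrow> e \<subseteq> V \<and> card e = 2"
    and len: "\<And>xs. vertex_cycle E xs \<Longrightarrow> length xs = r"
  shows "card E \<le> 4"
proof (rule ccontr)
  assume big: "\<not> card E \<le> 4"
  have fin: "finite V" "V \<noteq> {}" using V by (auto intro: card_ge_0_finite)
  have finE: "finite E" using big by (metis card.infinite zero_le)
  obtain v where v: "v \<in> V" "card {e \<in> E. v \<in> e} \<le> 2"
    using exists_degree_le_2[OF fin E len] by blast
  let ?T = "{e. e \<subseteq> V - {v} \<and> card e = 2}"
  have cV: "card (V - {v}) = 3" using V v(1) fin by simp
  have finT: "finite ?T" using fin by auto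
  have cT: "card ?T = 3"
    using n_subsets[of "V - {v}" 2] fin cV by (simp add: choose_two)
  have sub: "{e \<in> E. v \<notin> e} \<subseteq> ?T" using E by auto
  have split: "card E = card {e \<in> E. v \<in> e} + card {e \<in> E. v \<notin> e}"
    using finE by (subst card_Un_disjoint[symmetric]) (auto intro!: arg_cong[where f = card])
  have "card {e \<in> E. v \<notin> e} \<le> 3" using card_mono[OF finT sub] cT by simp
  then have deg: "card {e \<in> E. v \<in> e} = 2" and "card {e \<in> E. v \<notin> e} = 3"
    using split big v(2) by linarith+
  then have T: "{e \<in> E. v \<notin> e} = ?T" using card_subset_eq[OF finT sub] cT by simp
  obtain e f where ef: "{e \<in> E. v \<in> e} = {e, f}" "e \<noteq> f" using deg by (auto simp: card_2_iff)
  then have efE: "e \<in> E" "v \<in> e" "f \<in> E" "v \<in> f" by auto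
  obtain a where a: "e = {v, a}" "a \<noteq> v" using efE E[of e] by (auto simp: card_2_iff)
  obtain b where b: "f = {v, b}" "b \<noteq> v" using efE E[of f] by (auto simp: card_2_iff)
  have ab: "a \<in> V" "b \<in> V" "a \<noteq> b" using E[of e] E[of f] efE a b ef(2) by auto
  \<comment> \<open>The remaining vertex \<open>c\<close> replaces the edge \<open>{a, b}\<close> by
    a detour: \<open>v, a, c, b\<close> is the 4-cycle beside the triangle
    \<open>a, b, c\<close>.\<close>
  have "card (V - {v} - {a, b}) = 1" using cV ab a b fin by (simp add: card_Diff_subset)
  then obtain c where "V - {v} - {a, b} = {c}" by (auto simp: card_1_singleton_iff)
  then have c: "c \<in> V" "c \<noteq> v" "c \<noteq> a" "c \<noteq> b" by auto
  have "{a, b} \<in> ?T" "{b, c} \<in> ?T" "{c, a} \<in> ?T" using a b c ab by auto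
  then have "{a, b} \<in> E" "{b, c} \<in> E" "{c, a} \<in> E" using T by auto
  then have "vertex_cycle E [a, b, c]" "vertex_cycle E [v, a, c, b]"
    using efE a b c ab by (auto simp: vertex_cycle_def insert_commute)
  then show False using len[of "[a, b, c]"] len[of "[v, a, c, b]"] by simp
qed

text \<open>Deleting \<open>v\<close> loses at most two edges while the bound drops by exactly 2. A
  fixed \<open>r\<close> for all cycles, unlike equality of girth and circumference, still makes
  sense if the deletion leaves no cycle.\<close>

lemma card_edges_le_of_uniform_cycles:
  assumes "finite V" "4 \<le> card V"
    and "\<And>e. e \<in> E \<Longrightarrow> e \<subseteq> V \<and> card e = 2"
    and "\<And>xs. vertex_cycle E xs \<Longrightarrow> length xs = r"
  shows "card E \<le> 2 * card V - 4"
  using assms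
proof (induction "card V" arbitrary: V E rule: less_induct)
  case less
  show ?case
  proof (cases "card V = 4")
    case True
    then show ?thesis using card_edges_le_of_4_vertices[of V E r] less.prems by simp
  next
    case False
    have "V \<noteq> {}" using less.prems(2) by auto
    then obtain v where v: "v \<in> V" "card {e \<in> E. v \<in> e} \<le> 2"
      using exists_degree_le_2[of V E r] less.prems by blast
    let ?E = "{e \<in> E. v \<notin> e}"
    have "E \<subseteq> Pow V" using less.prems(3) by auto
    then have finE: "finite E" using less.prems(1) by (metis finite_Pow_iff finite_subset)
    have cV: "card V = Suc (card (V - {v}))" using v(1) less.prems(1) by (intro card.remove)
    have "card ?E \<le> 2 * card (V - {v}) - 4"
    proof (rule less.hyps)
      show "card (V - {v}) < card V" "4 \<le> card (V - {v})"
        using cV False less.prems(2) by linarith+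
      show "finite (V - {v})" using less.prems(1) by simp
      show "e \<subseteq> V - {v} \<and> card e = 2" if "e \<in> ?E" for e
        using that less.prems(3) by blast
      show "length xs = r" if "vertex_cycle ?E xs" for xs
        using that
        by (intro less.prems(4)) (auto simp: vertex_cycle_def elim: successively_mono)
    qed
    moreover have "card E = card {e \<in> E. v \<in> e} + card ?E"
      using finE by (subst card_Un_disjoint[symmetric]) (auto intro!: arg_cong[where f = card])
    \<comment> \<open>At least four vertices remain, so the subtraction of 4 is not
      truncated.\<close>
    ultimately show ?thesis using cV v(2) less.prems(2) False by linarith
  qed
qed

context Digraph.graph
begin

text \<open>An unordered edge may stem from an arc in either direction; symmetry of \<open>G\<close>
  supplies the one from \<open>u\<close> to \<open>v\<close>.\<close>

lemma edges_imp_arc: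
  assumes "{u, v} \<in> edges G"
  obtains e where "e \<in> arcs G" "tail G e = u" "head G e = v"
proof -
  obtain e where e: "e \<in> arcs G" "{tail G e, head G e} = {u, v}"
    using assms by (auto simp: edges_def)
  then have "u \<rightarrow>\<^bsub>G\<^esub> v \<or> v \<rightarrow>\<^bsub>G\<^esub> u"
    by (metis doubleton_eq_iff in_arcs_imp_in_arcs_ends)
  then have "u \<rightarrow>\<^bsub>G\<^esub> v" by (metis adj_in_verts graph_symmetric)
  then show thesis using that by (auto simp: arcs_ends_def arc_to_ends_def)
qed

lemma edges_subset_and_card:
  assumes "e \<in> edges G"
  shows "e \<subseteq> verts G \<and> card e = 2"
  using assms no_loops by (auto simp: edges_def)

lemma awalk_of_successive_edges:
  assumes "successively (\<lambda>x y. {x, y} \<in> edges G) (u # xs)" "u \<in> verts G"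
  shows "\<exists>p. awalk u p (last (u # xs)) \<and> awalk_verts u p = u # xs"
  using assms
proof (induction xs arbitrary: u)
  case Nil
  then show ?case by (intro exI[of _ "[]"]) (simp add: awalk_Nil_iff)
next
  case (Cons x xs)
  then obtain e where e: "e \<in> arcs G" "tail G e = u" "head G e = x"
    using edges_imp_arc by (metis successively.simps(3))
  moreover obtain p where "awalk x p (last (x # xs))" "awalk_verts x p = x # xs"
    using Cons e by fastforce
  ultimately show ?case by (intro exI[of _ "e # p"]) (auto simp: awalk_Cons_iff)
qed

lemma graph_cycle_of_vertex_cycle:
  assumes "vertex_cycle (edges G) xs"
  shows "\<exists>p. graph_cycle G p \<and> length p = length xs"
proof -
  obtain u ys where u: "xs = u # ys"
    using assms by (cases xs) (auto simp: vertex_cycle_def)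
  \<comment> \<open>Repeating the first vertex at the end turns the closing edge into an ordinary
    step. The closed walk then has as many arcs as \<open>xs\<close> has vertices, and the tail of
    its vertex list, \<open>ys @ [u]\<close>, is distinct as \<open>cycle\<close> demands.\<close>
  have "successively (\<lambda>x y. {x, y} \<in> edges G) (xs @ [u])"
    using assms u by (auto simp only: vertex_cycle_def successively_append_iff list.sel
        successively.simps)
  then have "successively (\<lambda>x y. {x, y} \<in> edges G) (u # (ys @ [u]))" using u by simp
  moreover have "u \<in> verts G"
    using assms u edges_subset_and_card by (auto simp: vertex_cycle_def)
  ultimately obtain p where p: "awalk u p u" "awalk_verts u p = u # (ys @ [u])"
    using awalk_of_successive_edges[of u "ys @ [u]"] by auto
  then have "length p = length xs"
    using length_awalk_verts[of u p] u by simp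
  moreover from this have "graph_cycle G p"
    using p assms u by (auto simp: graph_cycle_def cycle_def vertex_cycle_def)
  ultimately show ?thesis by blast
qed

text \<open>The length is squeezed between the minimum and the maximum of a finite set, which
  coincide.\<close>

lemma length_vertex_cycle:
  assumes "girth G = circum G" "vertex_cycle (edges G) xs"
  shows "length xs = girth G"
proof -
  have "length xs \<in> cycle_lengths G"
    using graph_cycle_of_vertex_cycle[OF assms(2)] by (force simp: cycle_lengths_def)
  then have "girth G \<le> length xs" "length xs \<le> circum G"
    using finite_cycle_lengths[OF graph_axioms] by (simp_all add: girth_def circum_def)
  then show ?thesis using assms(1) by simp
qed

end

theorem corollary4p10:
  fixes G :: "('a, 'b) pre_digraph" and n r :: nat
  assumes "Digraph.graph G"
    and "Digraph_Component.connected G"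
    and "Defs.planar G"
    and "card (verts G) = n" and "n \<ge> 4"
    and "\<exists>p. Defs.graph_cycle G p"
    and "r = Defs.girth G" and "Defs.girth G = Defs.circum G"
  shows "card (Defs.edges G) \<le> 2 * n - 4"
proof -
  interpret Digraph.graph G by fact
  show ?thesis
    using card_edges_le_of_uniform_cycles[OF finite_verts _ edges_subset_and_card
        length_vertex_cycle[OF assms(8)]] assms(4,5)
    by simp
qed

end
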